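(* For any simplicial complex $\Delta$ and any matching tree of $\Delta$, the matching of $\Delta$ obtained by taking the union of all partial matchings $M(A,\mathcal{B},p)$ performed at the matching sites $(A,\mathcal{B},p)$ of the tree is Morse.
   Context: $\Delta$ is an abstract simplicial complex on a finite vertex set $V$ (all singletons of $V$ are faces; the empty set is a face). Morse matchings. Consider the Hasse diagram of the face poset of $\Delta$ (all faces, including $\emptyset$, ordered by inclusion) as a directed graph with edges pointing from larger to smaller elements. A matching is a set of pairwise disjoint edges of this graph. It is Morse if reversing the direction of the edges in the matching gives an acyclic directed graph. Notation. For $S\subseteq V$ put $\mathcal{D}(S):=\{H\in\Delta : H\cup S\notin\Delta\}$. For a family $\mathcal{B}$ of subsets of $V$, let $\mathcal{B}^*$ be the subfamily of its one-point sets and $V(\mathcal{B}^* )\subseteq V$ the union of these. For $A\subseteq V$ put $$\Sigma(A,\mathcal{B}):=\{I\in\Delta : A\subseteq I \text{ and } B\nsubseteq I \text{ for all } \emptyset\ne B\in\mathcal{B}\}.$$ Let $\mathcal{D}_{up}^{\mathcal{B}}(S)$ denote the set of inclusion-minimal elements of $\mathcal{D}(S)\cup\{B\setminus S : \emptyset\neq B\in\mathcal{B}\}$; write $\mathcal{D}_{up}^{\mathcal{B}}(p)$ for $\mathcal{D}_{up}^{\mathcal{B}}(\{p\})$. The empty member of $\mathcal{B}$, if present, is always disregarded. Matching trees. A matching tree of $\Delta$ is a finite rooted tree with nodes of the form $\Sigma(A,\mathcal{B})$ or $\emptyset$, where for non-empty nodes $\Sigma(A,\mathcal{B})$ one has $A\cap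 V(\mathcal{B}^* )=\emptyset$ and every $D\in\mathcal{D}(A)$ contains some non-empty $B\in\mathcal{B}$. The root is $\Sigma(\emptyset,\{\emptyset\})=\Delta$. If a node is the empty set, it is a leaf. If a node $\Sigma(A,\mathcal{B})$ is non-empty and $A\cup V(\mathcal{B}^* )=V$, then it equals $\{A\}$ and is a leaf. Otherwise one picks a vertex $p\in V\setminus(A\cup V(\mathcal{B}^* ))$ and proceeds as follows. (i) If there is at most one $\gamma\in\mathcal{D}_{up}^{\mathcal{B}}(p)$ such that $B\nsubseteq\gamma$ for all non-empty $B\in\mathcal{B}$, then $(A,\mathcal{B},p)$ is called a matching site with pivot $p$. Put $$\Delta(A,\mathcal{B},p):=\{I\in\Sigma(A,\mathcal{B}) : H\nsubseteq I \text{ for all } H\in\mathcal{D}_{up}^{\mathcal{B}}(p)\},$$ $$M(A,\mathcal{B},p):=\{(I,I\cup\{p\}) : I\in\Delta(A,\mathcal{B},p),\ p\notin I\},$$ which is a perfect matching of $\Delta(A,\mathcal{B},p)$. The node has a unique child $U=\Sigma(A,\mathcal{B})\setminus\Delta(A,\mathcal{B},p)$: it is $\emptyset$ if no such $\gamma$ exists, and it is $\Sigma(A\cup\gamma,\ \mathcal{B}\cup\mathcal{D}_{up}^{\mathcal{B}}(\gamma))$ if there is exactly one such $\gamma$. (ii) If there are at least two elements $\gamma\in\mathcal{D}_{up}^{\mathcal{B}}(p)$ such that $B\nsubseteq\gamma$ for all non-empty $B\in\mathcal{B}$, one chooses one such $\gamma$; then $(A,\mathcal{B},\gamma)$ is called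 a splitting site, and the node has two children, the left child $\Sigma(A,\mathcal{B}\cup\{\gamma\})$ and the right child $\Sigma(A\cup\gamma,\ \mathcal{B}\cup\mathcal{D}_{up}^{\mathcal{B}}(\gamma))$. *)

theory Defs
  imports Main
begin

definition simplicial_complex :: "'v set \<Rightarrow> 'v set set \<Rightarrow> bool" where
  "simplicial_complex V \<Delta> \<longleftrightarrow>
     finite V \<and> \<Delta> \<subseteq> Pow V \<and> {} \<in> \<Delta> \<and> (\<forall>v\<in>V. {v} \<in> \<Delta>) \<and>
     (\<forall>F\<in>\<Delta>. \<forall>G. G \<subseteq> F \<longrightarrow> G \<in> \<Delta>)"

text \<open>Edges of the Hasse diagram point from the larger to the smaller face.\<close>

definition hasse :: "'v set set \<Rightarrow> ('v set \<times> 'v set) set" where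
  "hasse \<Delta> = {(T, S). T \<in> \<Delta> \<and> S \<in> \<Delta> \<and> S \<subset> T \<and> \<not> (\<exists>R\<in>\<Delta>. S \<subset> R \<and> R \<subset> T)}"

definition is_matching :: "('n \<times> 'n) set \<Rightarrow> ('n \<times> 'n) set \<Rightarrow> bool" where
  "is_matching E M \<longleftrightarrow> M \<subseteq> E \<and>
     (\<forall>(a, b)\<in>M. \<forall>(c, d)\<in>M. (a, b) \<noteq> (c, d) \<longrightarrow> {a, b} \<inter> {c, d} = {})"

definition is_Morse :: "('n \<times> 'n) set \<Rightarrow> ('n \<times> 'n) set \<Rightarrow> bool" where
  "is_Morse E M \<longleftrightarrow> is_matching E M \<and> acyclic ((E - M) \<union> M\<inverse>)"

definition \<D> :: "'v set set \<Rightarrow> 'v set \<Rightarrow> 'v set set" where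
  "\<D> \<Delta> S = {H \<in> \<Delta>. H \<union> S \<notin> \<Delta>}"

text \<open>The vertex set \<open>V(\<B>\<^sup>*)\<close>.\<close>

definition Vstar :: "'v set set \<Rightarrow> 'v set" where
  "Vstar \<B> = {v. {v} \<in> \<B>}"

definition Sig :: "'v set set \<Rightarrow> 'v set \<Rightarrow> 'v set set \<Rightarrow> 'v set set" where
  "Sig \<Delta> A \<B> = {I \<in> \<Delta>. A \<subseteq> I \<and> (\<forall>B\<in>\<B>. B \<noteq> {} \<longrightarrow> \<not> B \<subseteq> I)}"

definition minimals :: "'v set set \<Rightarrow> 'v set set" where
  "minimals X = {H \<in> X. \<not> (\<exists>K\<in>X. K \<subset> H)}"

definition \<D>up :: "'v set set \<Rightarrow> 'v set set \<Rightarrow> 'v set \<Rightarrow> 'v set set" where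
  "\<D>up \<Delta> \<B> S = minimals (\<D> \<Delta> S \<union> {B - S | B. B \<in> \<B> \<and> B \<noteq> {}})"

text \<open>The elements \<open>\<gamma>\<close> whose number decides between a matching and a splitting site.\<close>

definition candidates :: "'v set set \<Rightarrow> 'v set set \<Rightarrow> 'v \<Rightarrow> 'v set set" where
  "candidates \<Delta> \<B> p = {\<gamma> \<in> \<D>up \<Delta> \<B> {p}. \<forall>B\<in>\<B>. B \<noteq> {} \<longrightarrow> \<not> B \<subseteq> \<gamma>}"

definition site_faces :: "'v set set \<Rightarrow> 'v set \<Rightarrow> 'v set set \<Rightarrow> 'v \<Rightarrow> 'v set set" where
  "site_faces \<Delta> A \<B> p = {I \<in> Sig \<Delta> A \<B>. \<forall>H\<in>\<D>up \<Delta> \<B> {p}. \<not> H \<subseteq> I}"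

text \<open>The pairs are written smaller face first, so an edge of the Hasse diagram is the
  converse of such a pair.\<close>

definition site_matching ::
    "'v set set \<Rightarrow> 'v set \<Rightarrow> 'v set set \<Rightarrow> 'v \<Rightarrow> ('v set \<times> 'v set) set" where
  "site_matching \<Delta> A \<B> p = {(I, I \<union> {p}) | I. I \<in> site_faces \<Delta> A \<B> p \<and> p \<notin> I}"

text \<open>A node is recorded through its presentation \<open>(A, \<B>)\<close>, on which its children depend;
  \<open>EmptyNode\<close> is the node \<open>\<emptyset>\<close> below a matching site without candidate. A node
  \<open>SigNode A \<B>\<close> may also denote the empty set, and is then a leaf as well.\<close>

datatype 'v node = EmptyNode | SigNode "'v set" "'v set set"

fun node_set :: "'v set set \<Rightarrow> 'v node \<Rightarrow> 'v set set" where
  "node_set \<Delta> EmptyNode = {}"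
| "node_set \<Delta> (SigNode A \<B>) = Sig \<Delta> A \<B>"

datatype 'v mtree =
    Leaf "'v node"
  | MatchingSite "'v set" "'v set set" 'v "'v mtree"
  | SplittingSite "'v set" "'v set set" "'v set" "'v mtree" "'v mtree"

fun root_node :: "'v mtree \<Rightarrow> 'v node" where
  "root_node (Leaf n) = n"
| "root_node (MatchingSite A \<B> p t) = SigNode A \<B>"
| "root_node (SplittingSite A \<B> \<gamma> l r) = SigNode A \<B>"

text \<open>The condition on the non-empty nodes of a matching tree.\<close>

definition nonempty_node :: "'v set set \<Rightarrow> 'v set \<Rightarrow> 'v set set \<Rightarrow> bool" where
  "nonempty_node \<Delta> A \<B> \<longleftrightarrow> Sig \<Delta> A \<B> \<noteq> {} \<and> A \<inter> Vstar \<B> = {} \<and>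
     (\<forall>D\<in>\<D> \<Delta> A. \<exists>B\<in>\<B>. B \<noteq> {} \<and> B \<subseteq> D)"

text \<open>\<open>is_mtree\<close> leaves the root arbitrary.\<close>

inductive is_mtree :: "'v set \<Rightarrow> 'v set set \<Rightarrow> 'v mtree \<Rightarrow> bool" for V \<Delta> where
  empty_leaf: "node_set \<Delta> n = {} \<Longrightarrow> is_mtree V \<Delta> (Leaf n)"
| full_leaf: "\<lbrakk>nonempty_node \<Delta> A \<B>; A \<union> Vstar \<B> = V\<rbrakk>
    \<Longrightarrow> is_mtree V \<Delta> (Leaf (SigNode A \<B>))"
| matching_empty: "\<lbrakk>nonempty_node \<Delta> A \<B>; p \<in> V - (A \<union> Vstar \<B>);
      candidates \<Delta> \<B> p = {}\<rbrakk>
    \<Longrightarrow> is_mtree V \<Delta> (MatchingSite A \<B> p (Leaf EmptyNode))"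
| matching_unique: "\<lbrakk>nonempty_node \<Delta> A \<B>; p \<in> V - (A \<union> Vstar \<B>);
      candidates \<Delta> \<B> p = {\<gamma>};
      is_mtree V \<Delta> t; root_node t = SigNode (A \<union> \<gamma>) (\<B> \<union> \<D>up \<Delta> \<B> \<gamma>)\<rbrakk>
    \<Longrightarrow> is_mtree V \<Delta> (MatchingSite A \<B> p t)"
| splitting: "\<lbrakk>nonempty_node \<Delta> A \<B>; p \<in> V - (A \<union> Vstar \<B>);
      \<gamma> \<in> candidates \<Delta> \<B> p; \<gamma>' \<in> candidates \<Delta> \<B> p; \<gamma>' \<noteq> \<gamma>;
      is_mtree V \<Delta> l; root_node l = SigNode A (\<B> \<union> {\<gamma>});
      is_mtree V \<Delta> r; root_node r = SigNode (A \<union> \<gamma>) (\<B> \<union> \<D>up \<Delta> \<B> \<gamma>)\<rbrakk>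
    \<Longrightarrow> is_mtree V \<Delta> (SplittingSite A \<B> \<gamma> l r)"

definition matching_tree :: "'v set \<Rightarrow> 'v set set \<Rightarrow> 'v mtree \<Rightarrow> bool" where
  "matching_tree V \<Delta> t \<longleftrightarrow> is_mtree V \<Delta> t \<and> root_node t = SigNode {} {{}}"

fun matching_sites :: "'v mtree \<Rightarrow> ('v set \<times> 'v set set \<times> 'v) set" where
  "matching_sites (Leaf n) = {}"
| "matching_sites (MatchingSite A \<B> p t) = insert (A, \<B>, p) (matching_sites t)"
| "matching_sites (SplittingSite A \<B> \<gamma> l r) = matching_sites l \<union> matching_sites r"

definition tree_matching :: "'v set set \<Rightarrow> 'v mtree \<Rightarrow> ('v set \<times> 'v set) set" where
  "tree_matching \<Delta> t = (\<Union>(A, \<B>, p)\<in>matching_sites t. site_matching \<Delta> A \<B> p)"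

end

theory Submission
  imports Defs
begin

text \<open>
  Each branching of a matching tree cuts the current node along a single face \<open>\<gamma>\<close>: one part
  consists of the faces of the node that contain \<open>\<gamma>\<close>, the other of those that do not. At a
  splitting site these parts are the right and the left child; at a matching site with the
  unique candidate \<open>\<gamma>\<close> they are the child and the set of faces matched at the site (without
  a candidate there is no cut, and the site matches the whole node). Edges
  of the Hasse diagram pass to subsets, so none leads from the faces without \<open>\<gamma>\<close> to those with
  \<open>\<gamma>\<close>, and matched edges stay inside one part. A directed cycle therefore cannot visit both
  parts, and Morse matchings of the two parts combine to a Morse matching of the node
  (\<open>is_Morse_split_by_face\<close>).

  It remains to treat a single site with pivot \<open>p\<close>. There the matched faces form a family closed
  under adding \<open>p\<close>. Going up along a matched edge keeps \<open>I - {p}\<close> and adds \<open>p\<close>; going down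
  along an unmatched edge strictly decreases \<open>I - {p}\<close>, since an edge that only removes \<open>p\<close>
  is matched. So no directed cycle exists (\<open>is_Morse_add_vertex\<close>). Induction over
  the tree then yields the theorem, the invariant being that the matching of each
  subtree is Morse in the Hasse diagram restricted to the faces of its root node.
\<close>

section \<open>Morse matchings of two-part decompositions\<close>

text \<open>Once a path has moved from the second part to the first it can never return, so every
  path is a path within one part or it crosses for good.\<close>

lemma acyclic_one_way_union:
  assumes "acyclic R" "acyclic S" "R \<subseteq> X \<times> X" "S \<subseteq> Y \<times> Y" "X \<inter> Y = {}"
  shows "acyclic (R \<union> S \<union> Y \<times> X)"
proof -
  have R: "R\<^sup>+ \<subseteq> X \<times> X" and S: "S\<^sup>+ \<subseteq> Y \<times> Y"
    using assms(3,4) by (auto dest: trancl_subset_Sigma)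
  have path: "(a, b) \<in> R\<^sup>+ \<or> (a, b) \<in> S\<^sup>+ \<or> a \<in> Y \<and> b \<in> X"
    if "(a, b) \<in> (R \<union> S \<union> Y \<times> X)\<^sup>+" for a b
    using that
  proof induction
    case (base b)
    then show ?case by auto
  next
    case (step b c)
    from step.hyps(2) consider "(b, c) \<in> R" | "(b, c) \<in> S" | "b \<in> Y" "c \<in> X" by blast
    then show ?case
    proof cases
      case 1
      then have "b \<in> X" "c \<in> X" using assms(3) by auto
      with 1 step.IH S assms(5) show ?thesis by (auto intro: trancl_into_trancl)
    next
      case 2
      then have "b \<in> Y" using assms(4) by auto
      with 2 step.IH R assms(5) show ?thesis by (auto intro: trancl_into_trancl)
    next
      case 3
      with step.IH R S assms(5) show ?thesis by auto
    qed
  qed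
  show ?thesis
    unfolding acyclic_def
  proof
    fix a
    show "(a, a) \<notin> (R \<union> S \<union> Y \<times> X)\<^sup>+"
      using path[of a a] assms(1,2,5) by (auto simp: acyclic_def)
  qed
qed

lemma is_Morse_one_way_union:
  assumes "is_Morse (Restr E X) M" "is_Morse (Restr E Y) N" "X \<inter> Y = {}"
    and one_way: "\<And>a b. (a, b) \<in> E \<Longrightarrow> a \<in> X \<Longrightarrow> b \<notin> Y"
  shows "is_Morse (Restr E (X \<union> Y)) (M \<union> N)"
proof -
  have M: "M \<subseteq> Restr E X" and N: "N \<subseteq> Restr E Y"
    using assms(1,2) by (auto simp: is_Morse_def is_matching_def)
  have cross: "{a, b} \<inter> {c, d} = {}" if "(a, b) \<in> M" "(c, d) \<in> N" for a b c d
    using that M N assms(3) by blast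
  have matching: "is_matching (Restr E (X \<union> Y)) (M \<union> N)"
    unfolding is_matching_def
  proof (intro conjI ballI, goal_cases)
    case 1
    then show ?case using M N by blast
  next
    case (2 e)
    obtain a b where e: "e = (a, b)" by (cases e)
    have disjoint: "{a, b} \<inter> {c, d} = {}" if "(c, d) \<in> M \<union> N" "(a, b) \<noteq> (c, d)" for c d
    proof -
      consider "(a, b) \<in> M" "(c, d) \<in> M" | "(a, b) \<in> N" "(c, d) \<in> N"
        | "(a, b) \<in> M" "(c, d) \<in> N" | "(a, b) \<in> N" "(c, d) \<in> M"
        using 2 e \<open>(c, d) \<in> M \<union> N\<close> by blast
      then show ?thesis
      proof cases
        case 1
        with assms(1) that(2) show ?thesis unfolding is_Morse_def is_matching_def by blast
      next
        case 2
        with assms(2) that(2) show ?thesis unfolding is_Morse_def is_matching_def by blast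
      next
        case 3
        then show ?thesis by (rule cross)
      next
        case 4
        then show ?thesis using cross[of c d a b] by (simp add: Int_commute)
      qed
    qed
    then show ?case using e by blast
  qed
  let ?R = "(Restr E X - M) \<union> M\<inverse>" and ?S = "(Restr E Y - N) \<union> N\<inverse>"
  have "acyclic (?R \<union> ?S \<union> Y \<times> X)"
    using assms(1-3) M N by (intro acyclic_one_way_union) (auto simp: is_Morse_def)
  moreover have "(Restr E (X \<union> Y) - (M \<union> N)) \<union> (M \<union> N)\<inverse> \<subseteq> ?R \<union> ?S \<union> Y \<times> X"
    using one_way by auto
  ultimately have "acyclic ((Restr E (X \<union> Y) - (M \<union> N)) \<union> (M \<union> N)\<inverse>)"
    by (rule acyclic_subset)
  with matching show ?thesis by (simp add: is_Morse_def)
qed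

lemma is_Morse_split_by_face:
  assumes "is_Morse (Restr (hasse \<Delta>) {I \<in> X. \<not> \<gamma> \<subseteq> I}) M"
    and "is_Morse (Restr (hasse \<Delta>) {I \<in> X. \<gamma> \<subseteq> I}) N"
  shows "is_Morse (Restr (hasse \<Delta>) X) (M \<union> N)"
proof -
  have "X = {I \<in> X. \<not> \<gamma> \<subseteq> I} \<union> {I \<in> X. \<gamma> \<subseteq> I}" by blast
  moreover have "is_Morse (Restr (hasse \<Delta>) ({I \<in> X. \<not> \<gamma> \<subseteq> I} \<union> {I \<in> X. \<gamma> \<subseteq> I})) (M \<union> N)"
    using assms by (rule is_Morse_one_way_union) (auto simp: hasse_def)
  ultimately show ?thesis by simp
qed

lemma is_Morse_empty: "is_Morse (Restr (hasse \<Delta>) X) {}"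
proof -
  have "trans {(T, S :: 'a set). S \<subset> T}" by (rule transI) auto
  then have "acyclic {(T, S :: 'a set). S \<subset> T}"
    by (simp add: acyclic_def trancl_id)
  then have "acyclic (Restr (hasse \<Delta>) X)"
    by (rule acyclic_subset) (auto simp: hasse_def)
  then show ?thesis by (simp add: is_Morse_def is_matching_def)
qed

section \<open>The matching at a single site\<close>

text \<open>The two kinds of steps strictly decrease \<open>(I - {p}, p \<notin> I)\<close> in the lexicographic
  order.\<close>

lemma is_Morse_add_vertex:
  assumes "F \<subseteq> \<Delta>" and fin: "\<And>I. I \<in> F \<Longrightarrow> finite I"
    and closed: "\<And>I. I \<in> F \<Longrightarrow> insert p I \<in> F"
  shows "is_Morse (Restr (hasse \<Delta>) F) ({(I, insert p I) | I. I \<in> F \<and> p \<notin> I}\<inverse>)"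
    (is "is_Morse ?E (?M\<inverse>)")
proof -
  have "?M\<inverse> \<subseteq> ?E"
    using assms(1) closed by (fastforce simp: hasse_def)
  moreover have "{a, b} \<inter> {c, d} = {}"
    if "(b, a) \<in> ?M" "(d, c) \<in> ?M" "(a, b) \<noteq> (c, d)" for a b c d
    using that by (auto dest: insert_ident)
  ultimately have matching: "is_matching ?E (?M\<inverse>)"
    unfolding is_matching_def by blast
  \<comment> \<open>The lexicographic order in one number: the second component is at most 1, and the
    factor 2 makes any decrease of the first component outweigh it.\<close>
  define f where "f = (\<lambda>I. 2 * card (I - {p}) + (if p \<in> I then 0 else 1))"
  have decr: "f S < f T" if "(T, S) \<in> (?E - ?M\<inverse>) \<union> (?M\<inverse>)\<inverse>" for T S
  proof (cases "(T, S) \<in> ?M")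
    case True
    then show ?thesis by (auto simp: f_def)
  next
    case False
    with that have TS: "T \<in> F" "S \<in> F" "S \<subset> T" and unmatched: "(S, T) \<notin> ?M"
      by (auto simp: hasse_def)
    have "S - {p} \<noteq> T - {p}"
    proof
      assume "S - {p} = T - {p}"
      with TS(3) have "T = insert p S" "p \<notin> S" by auto
      with TS unmatched show False by blast
    qed
    with TS have "S - {p} \<subset> T - {p}" by blast
    then have "card (S - {p}) < card (T - {p})"
      using fin[OF TS(1)] by (simp add: psubset_card_mono)
    moreover have "f S \<le> 2 * card (S - {p}) + 1" "2 * card (T - {p}) \<le> f T"
      unfolding f_def by (rule add_left_mono, simp) (rule le_add1)
    ultimately show ?thesis by linarith
  qed
  have "acyclic ((?E - ?M\<inverse>) \<union> (?M\<inverse>)\<inverse>)"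
    by (rule acyclicI_order[of _ f]) (rule decr)
  with matching show ?thesis by (simp add: is_Morse_def)
qed

lemma minimals_below:
  assumes "finite H" "H \<in> X"
  shows "\<exists>K\<in>minimals X. K \<subseteq> H"
  using assms
proof (induction rule: finite_psubset_induct)
  case (psubset H)
  show ?case
  proof (cases "H \<in> minimals X")
    case True
    then show ?thesis by (rule bexI[rotated]) simp
  next
    case False
    with psubset.prems obtain K where K: "K \<in> X" "K \<subset> H" by (auto simp: minimals_def)
    from psubset.IH[OF K(2,1)] obtain L where "L \<in> minimals X" "L \<subseteq> K" by (rule bexE)
    moreover from this K have "L \<subseteq> H" by simp
    ultimately show ?thesis by (intro bexI)
  qed
qed

lemma simplicial_complex_finite:
  "simplicial_complex V \<Delta> \<Longrightarrow> I \<in> \<Delta> \<Longrightarrow> finite I"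
  by (auto simp: simplicial_complex_def intro: finite_subset)

text \<open>Any obstruction to adding \<open>p\<close> to a face, a missing face or a forbidden \<open>B\<close>, would
  lie above a member of \<open>\<D>up \<Delta> \<B> {p}\<close> contained in that face.\<close>

lemma site_faces_closed_insert:
  assumes \<Delta>: "simplicial_complex V \<Delta>" and I: "I \<in> site_faces \<Delta> A \<B> p"
  shows "insert p I \<in> site_faces \<Delta> A \<B> p"
proof -
  have "I \<in> \<Delta>" "A \<subseteq> I" and avoid: "\<And>H. H \<in> \<D>up \<Delta> \<B> {p} \<Longrightarrow> \<not> H \<subseteq> I"
    using I by (auto simp: site_faces_def Sig_def)
  let ?X = "\<D> \<Delta> {p} \<union> {B - {p} | B. B \<in> \<B> \<and> B \<noteq> {}}"
  have no_obstruction: "\<not> H \<subseteq> I" if "H \<in> ?X" for H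
  proof
    assume "H \<subseteq> I"
    moreover have "finite H"
      using \<open>H \<subseteq> I\<close> simplicial_complex_finite[OF \<Delta> \<open>I \<in> \<Delta>\<close>] by (rule finite_subset)
    ultimately show False
      using minimals_below[OF _ that] avoid unfolding \<D>up_def by blast
  qed
  have face: "insert p I \<in> \<Delta>"
    using no_obstruction[of I] \<open>I \<in> \<Delta>\<close> by (auto simp: \<D>_def)
  have "\<not> B \<subseteq> insert p I" if "B \<in> \<B>" "B \<noteq> {}" for B
    using no_obstruction[of "B - {p}"] that by blast
  moreover have "\<not> H \<subseteq> insert p I" if "H \<in> \<D>up \<Delta> \<B> {p}" for H
  proof -
    have "p \<notin> H"
      using that unfolding \<D>up_def minimals_def \<D>_def
      by (clarsimp simp: insert_absorb)
    with avoid[OF that] show ?thesis by blast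
  qed
  ultimately show ?thesis
    using face \<open>A \<subseteq> I\<close> by (auto simp: site_faces_def Sig_def)
qed

lemma is_Morse_site_matching:
  assumes "simplicial_complex V \<Delta>"
  shows "is_Morse (Restr (hasse \<Delta>) (site_faces \<Delta> A \<B> p)) ((site_matching \<Delta> A \<B> p)\<inverse>)"
proof -
  have "site_faces \<Delta> A \<B> p \<subseteq> \<Delta>" by (auto simp: site_faces_def Sig_def)
  moreover from this have "finite I" if "I \<in> site_faces \<Delta> A \<B> p" for I
    using that assms by (auto intro: simplicial_complex_finite)
  ultimately show ?thesis
    using is_Morse_add_vertex[of "site_faces \<Delta> A \<B> p" \<Delta> p]
      site_faces_closed_insert[OF assms] by (simp add: site_matching_def)
qed

section \<open>Children as parts of their parent\<close>

text \<open>A face containing \<open>\<gamma>\<close> automatically avoids \<open>\<D>up \<Delta> \<B> \<gamma>\<close>: together with \<open>\<gamma>\<close>, a member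
  of that family either spans a non-face or covers a forbidden \<open>B\<close>.\<close>

lemma Sig_add_face:
  assumes "simplicial_complex V \<Delta>"
  shows "Sig \<Delta> (A \<union> \<gamma>) (\<B> \<union> \<D>up \<Delta> \<B> \<gamma>) = {I \<in> Sig \<Delta> A \<B>. \<gamma> \<subseteq> I}"
proof -
  have avoid: "\<not> H \<subseteq> I" if "I \<in> Sig \<Delta> A \<B>" "\<gamma> \<subseteq> I" "H \<in> \<D>up \<Delta> \<B> \<gamma>" for H I
  proof
    assume "H \<subseteq> I"
    from that(3) consider "H \<union> \<gamma> \<notin> \<Delta>" | B where "B \<in> \<B>" "B \<noteq> {}" "H = B - \<gamma>"
      by (auto simp: \<D>up_def minimals_def \<D>_def)
    then show False
    proof cases
      case 1
      have "I \<in> \<Delta>" using that(1) by (simp add: Sig_def)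
      moreover have "H \<union> \<gamma> \<subseteq> I" using \<open>H \<subseteq> I\<close> that(2) by blast
      ultimately show False using assms 1 unfolding simplicial_complex_def by blast
    next
      case 2
      then have "B \<subseteq> I" using \<open>H \<subseteq> I\<close> that(2) by blast
      with 2 that(1) show False by (auto simp: Sig_def)
    qed
  qed
  show ?thesis
  proof (intro set_eqI iffI)
    fix I assume "I \<in> Sig \<Delta> (A \<union> \<gamma>) (\<B> \<union> \<D>up \<Delta> \<B> \<gamma>)"
    then show "I \<in> {I \<in> Sig \<Delta> A \<B>. \<gamma> \<subseteq> I}" by (simp add: Sig_def)
  next
    fix I assume "I \<in> {I \<in> Sig \<Delta> A \<B>. \<gamma> \<subseteq> I}"
    then have I: "I \<in> Sig \<Delta> A \<B>" "\<gamma> \<subseteq> I" by simp_all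
    show "I \<in> Sig \<Delta> (A \<union> \<gamma>) (\<B> \<union> \<D>up \<Delta> \<B> \<gamma>)"
      using I avoid[OF I] by (simp add: Sig_def ball_Un)
  qed
qed

lemma Sig_forbid_face:
  "\<gamma> \<noteq> {} \<Longrightarrow> Sig \<Delta> A (\<B> \<union> {\<gamma>}) = {I \<in> Sig \<Delta> A \<B>. \<not> \<gamma> \<subseteq> I}"
  unfolding Sig_def by (rule Collect_cong) auto

text \<open>A member of \<open>\<D>up \<Delta> \<B> {p}\<close> that is no candidate contains a forbidden \<open>B\<close>, and so lies in
  no face of the node anyway.\<close>

lemma site_faces_candidates:
  "site_faces \<Delta> A \<B> p = {I \<in> Sig \<Delta> A \<B>. \<forall>\<gamma>\<in>candidates \<Delta> \<B> p. \<not> \<gamma> \<subseteq> I}"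
proof -
  have "H \<in> candidates \<Delta> \<B> p"
    if "I \<in> Sig \<Delta> A \<B>" "H \<in> \<D>up \<Delta> \<B> {p}" "H \<subseteq> I" for H I
    using that order_trans[OF _ \<open>H \<subseteq> I\<close>] unfolding candidates_def Sig_def by simp metis
  moreover have "candidates \<Delta> \<B> p \<subseteq> \<D>up \<Delta> \<B> {p}"
    by (auto simp: candidates_def)
  ultimately show ?thesis unfolding site_faces_def by (intro Collect_cong) blast
qed

text \<open>This is what keeps the two children of a splitting site disjoint: the empty set would be a
  candidate only if \<open>p\<close> were no vertex or \<open>{p}\<close> were forbidden.\<close>

lemma candidate_nonempty:
  assumes "simplicial_complex V \<Delta>" "p \<in> V - (A \<union> Vstar \<B>)" "\<gamma> \<in> candidates \<Delta> \<B> p"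
  shows "\<gamma> \<noteq> {}"
proof
  assume "\<gamma> = {}"
  with assms(3) have "{p} \<notin> \<Delta> \<or> (\<exists>B\<in>\<B>. B \<noteq> {} \<and> B \<subseteq> {p})"
    by (auto simp: candidates_def \<D>up_def minimals_def \<D>_def)
  moreover have "{p} \<in> \<Delta>" "{p} \<notin> \<B>"
    using assms(1,2) by (auto simp: simplicial_complex_def Vstar_def)
  ultimately show False by (metis subset_singletonD)
qed

section \<open>Induction over the tree\<close>

lemma tree_matching_simps [simp]:
  "tree_matching \<Delta> (Leaf n) = {}"
  "tree_matching \<Delta> (MatchingSite A \<B> p t) = site_matching \<Delta> A \<B> p \<union> tree_matching \<Delta> t"
  "tree_matching \<Delta> (SplittingSite A \<B> \<gamma> l r) = tree_matching \<Delta> l \<union> tree_matching \<Delta> r"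
  by (auto simp: tree_matching_def)

lemma is_Morse_subtree:
  assumes \<Delta>: "simplicial_complex V \<Delta>" and "is_mtree V \<Delta> t"
  shows "is_Morse (Restr (hasse \<Delta>) (node_set \<Delta> (root_node t))) ((tree_matching \<Delta> t)\<inverse>)"
  using assms(2)
proof induction
  case (empty_leaf n)
  then show ?case using is_Morse_empty[of \<Delta> "{}"] by simp
next
  case (full_leaf A \<B>)
  then show ?case by (simp add: is_Morse_empty)
next
  case (matching_empty A \<B> p)
  then have "site_faces \<Delta> A \<B> p = Sig \<Delta> A \<B>" by (simp add: site_faces_candidates)
  then show ?case using is_Morse_site_matching[OF \<Delta>, of A \<B> p] by simp
next
  case (matching_unique A \<B> p \<gamma> t)
  then have "site_faces \<Delta> A \<B> p = {I \<in> Sig \<Delta> A \<B>. \<not> \<gamma> \<subseteq> I}"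
    by (simp add: site_faces_candidates)
  then have "is_Morse (Restr (hasse \<Delta>) {I \<in> Sig \<Delta> A \<B>. \<not> \<gamma> \<subseteq> I}) ((site_matching \<Delta> A \<B> p)\<inverse>)"
    using is_Morse_site_matching[OF \<Delta>, of A \<B> p] by simp
  moreover have "is_Morse (Restr (hasse \<Delta>) {I \<in> Sig \<Delta> A \<B>. \<gamma> \<subseteq> I}) ((tree_matching \<Delta> t)\<inverse>)"
    using matching_unique.IH matching_unique.hyps(5)
    by (simp only: Sig_add_face[OF \<Delta>] node_set.simps)
  ultimately have "is_Morse (Restr (hasse \<Delta>) (Sig \<Delta> A \<B>))
      ((site_matching \<Delta> A \<B> p)\<inverse> \<union> (tree_matching \<Delta> t)\<inverse>)"
    by (rule is_Morse_split_by_face)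
  then show ?case by (simp add: converse_Un)
next
  case (splitting A \<B> p \<gamma> \<gamma>' l r)
  then have "\<gamma> \<noteq> {}" using candidate_nonempty[OF \<Delta>] by blast
  then have "is_Morse (Restr (hasse \<Delta>) {I \<in> Sig \<Delta> A \<B>. \<not> \<gamma> \<subseteq> I}) ((tree_matching \<Delta> l)\<inverse>)"
    using splitting.IH(1) splitting.hyps(7)
    by (simp only: Sig_forbid_face[OF \<open>\<gamma> \<noteq> {}\<close>] node_set.simps)
  moreover have "is_Morse (Restr (hasse \<Delta>) {I \<in> Sig \<Delta> A \<B>. \<gamma> \<subseteq> I}) ((tree_matching \<Delta> r)\<inverse>)"
    using splitting.IH(2) splitting.hyps(9) by (simp only: Sig_add_face[OF \<Delta>] node_set.simps)
  ultimately have "is_Morse (Restr (hasse \<Delta>) (Sig \<Delta> A \<B>))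
      ((tree_matching \<Delta> l)\<inverse> \<union> (tree_matching \<Delta> r)\<inverse>)"
    by (rule is_Morse_split_by_face)
  then show ?case by (simp add: converse_Un)
qed

theorem theorem4p3:
  fixes V :: "'v set" and \<Delta> :: "'v set set" and t :: "'v mtree"
  assumes "simplicial_complex V \<Delta>"
    and "matching_tree V \<Delta> t"
  shows "is_Morse (hasse \<Delta>) ((tree_matching \<Delta> t)\<inverse>)"
proof -
  have "node_set \<Delta> (root_node t) = \<Delta>"
    using assms(2) by (simp add: matching_tree_def Sig_def)
  moreover have "Restr (hasse \<Delta>) \<Delta> = hasse \<Delta>" by (auto simp: hasse_def)
  ultimately show ?thesis
    using is_Morse_subtree[OF assms(1)] assms(2) by (metis matching_tree_def)
qed

end
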